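(* The matrices $$A=\begin{bmatrix} 6 & 0 \\ 0 & 5\end{bmatrix}, \qquad B=\begin{bmatrix} 0 & 1 \\ 1 & 0 \end{bmatrix}$$ have the property $A+B\geq 0$ and $A-B\geq 0$, and $$\|A+B\|_p^p+\|A-B\|_p^p \;\leq\; \|\sigma(A)+\sigma(B)\|_p^p+\|\sigma(A)-\sigma(B)\|_p^p$$ for $1\leq p\leq 2$ and for $3\leq p<\infty$, with the inequality reversing for $2\leq p\leq 3$.
   Context: For a self-adjoint matrix, $X\ge 0$ means that $X$ is positive semidefinite. For a matrix $X\in M_{n\times n}(\mathbb{C})$, $\|X\|_p=\operatorname{Tr}[(X^*X)^{p/2}]^{1/p}$ is the $p$-Schatten norm; for a vector $v\in\mathbb{R}^n$, $\|v\|_p=(\sum_i|v_i|^p)^{1/p}$. $\sigma(X)\in\mathbb{R}^n$ denotes the vector of singular values of $X$ (with multiplicity) in decreasing order. *)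

theory Defs
  imports
    Complex_Main
    "HOL-Library.Multiset"
    "HOL-Computational_Algebra.Polynomial"
    "Jordan_Normal_Form.Schur_Decomposition"
begin

definition self_adjoint_mat :: "complex mat \<Rightarrow> bool" where
  "self_adjoint_mat X \<longleftrightarrow> square_mat X \<and> mat_adjoint X = X"

text \<open>For self-adjoint \<open>X\<close> the quadratic form is real-valued, so taking \<open>Re\<close> loses nothing.\<close>

definition psd_mat :: "complex mat \<Rightarrow> bool" where
  "psd_mat X \<longleftrightarrow> self_adjoint_mat X \<and>
     (\<forall>v \<in> carrier_vec (dim_row X). 0 \<le> Re ((X *\<^sub>v v) \<bullet>c v))"

definition unitary_mat :: "complex mat \<Rightarrow> bool" where
  "unitary_mat U \<longleftrightarrow> square_mat U \<and>
     mat_adjoint U * U = 1\<^sub>m (dim_row U) \<and> U * mat_adjoint U = 1\<^sub>m (dim_row U)"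

text \<open>
  Functional calculus: \<open>Y = X ^ r\<close> for positive semidefinite \<open>X\<close>, obtained by raising the
  eigenvalues in a unitary diagonalisation to the power \<open>r\<close>. As \<open>0 powr r = 0\<close>,
  this is the usual power for \<open>r > 0\<close> (and the support projection for \<open>r = 0\<close>).
\<close>

definition is_mat_powr :: "complex mat \<Rightarrow> real \<Rightarrow> complex mat \<Rightarrow> bool" where
  "is_mat_powr X r Y \<longleftrightarrow>
     (\<exists>U d. U \<in> carrier_mat (dim_row X) (dim_row X) \<and> unitary_mat U \<and> (\<forall>i. 0 \<le> d i) \<and>
        X = U * mat_diag (dim_row X) (\<lambda>i. complex_of_real (d i)) * mat_adjoint U \<and>
        Y = U * mat_diag (dim_row X) (\<lambda>i. complex_of_real (d i powr r)) * mat_adjoint U)"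

lemma mat_adjoint_carrier: "A \<in> carrier_mat n m \<Longrightarrow> mat_adjoint A \<in> carrier_mat m n"
  unfolding mat_adjoint_def by auto

lemma is_mat_powr_unique:
  assumes "is_mat_powr X r Y" and "is_mat_powr X r Z"
  shows "Y = Z"
proof -
  define n where "n = dim_row X"
  from assms(1) obtain U d where U: "U \<in> carrier_mat n n" "unitary_mat U"
    and X1: "X = U * mat_diag n (\<lambda>i. complex_of_real (d i)) * mat_adjoint U"
    and Y: "Y = U * mat_diag n (\<lambda>i. complex_of_real (d i powr r)) * mat_adjoint U"
    unfolding is_mat_powr_def n_def by blast
  from assms(2) obtain V e where V: "V \<in> carrier_mat n n" "unitary_mat V"
    and X2: "X = V * mat_diag n (\<lambda>i. complex_of_real (e i)) * mat_adjoint V"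
    and Z: "Z = V * mat_diag n (\<lambda>i. complex_of_real (e i powr r)) * mat_adjoint V"
    unfolding is_mat_powr_def n_def by blast
  define U' V' W where "U' = mat_adjoint U" and "V' = mat_adjoint V" and "W = V' * U"
  have c: "U' \<in> carrier_mat n n" "V' \<in> carrier_mat n n" "W \<in> carrier_mat n n"
    using mat_adjoint_carrier[OF U(1)] mat_adjoint_carrier[OF V(1)] U(1) V(1)
    unfolding U'_def V'_def W_def by (auto intro: mult_carrier_mat)
  have u: "U' * U = 1\<^sub>m n" "U * U' = 1\<^sub>m n" "V' * V = 1\<^sub>m n" "V * V' = 1\<^sub>m n"
    using U V carrier_matD[OF U(1)] carrier_matD[OF V(1)] unfolding unitary_mat_def U'_def V'_def by metis+
  have assoc: "P * Q * R = P * (Q * R)"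
    if "P \<in> carrier_mat n n" "Q \<in> carrier_mat n n" "R \<in> carrier_mat n n" for P Q R :: "complex mat"
    using assoc_mult_mat[OF that] .
  have mc: "P * Q \<in> carrier_mat n n"
    if "P \<in> carrier_mat n n" "Q \<in> carrier_mat n n" for P Q :: "complex mat"
    using mult_carrier_mat[OF that] .
  have VW: "V * W = U"
    unfolding W_def assoc[OF V(1) c(2) U(1), symmetric] u using U(1) by simp
  have WU: "W * U' = V'"
    unfolding W_def assoc[OF c(2) U(1) c(1)] u using c(2) by simp
  define D E where "D = (\<lambda>s. mat_diag n (\<lambda>i. complex_of_real (s (d i))))"
    and "E = (\<lambda>s. mat_diag n (\<lambda>i. complex_of_real (s (e i))))"
  have DE: "D s \<in> carrier_mat n n" "E s \<in> carrier_mat n n" for s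
    by (auto simp: D_def E_def)
  note cs = U(1) V(1) c DE mc
  have 1: "V' * (U * D s * U') * U = W * D s" for s
  proof -
    have "V' * (U * D s * U') * U = V' * (U * (D s * (U' * U)))" by (simp only: assoc cs)
    also have "\<dots> = V' * (U * D s)" unfolding u right_mult_one_mat[OF DE(1)] ..
    finally show ?thesis unfolding W_def by (simp only: assoc cs)
  qed
  have 2: "V' * (V * E s * V') * U = E s * W" for s
  proof -
    have "V' * (V * E s * V') * U = V' * V * (E s * (V' * U))" by (simp only: assoc cs)
    also have "\<dots> = E s * (V' * U)" unfolding u using left_mult_one_mat[OF mc[OF DE(2) mc[OF c(2) U(1)]]] .
    finally show ?thesis unfolding W_def .
  qed
  have X1': "X = U * D (\<lambda>x. x) * U'" and X2': "X = V * E (\<lambda>x. x) * V'"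
    using X1 X2 by (simp_all add: D_def E_def U'_def V'_def)
  have WD: "W * D (\<lambda>x. x) = E (\<lambda>x. x) * W"
    using 1[of "\<lambda>x. x"] 2[of "\<lambda>x. x"] unfolding X1'[symmetric] X2'[symmetric] by (rule trans[OF sym])
  have *: "W $$ (i, j) * d j = e i * W $$ (i, j)" if "i < n" "j < n" for i j
    using arg_cong[OF WD, of "\<lambda>M. M $$ (i, j)"] that
    unfolding D_def E_def mat_diag_mult_left[OF c(3)] mat_diag_mult_right[OF c(3)] by simp
  have eq: "W * D (\<lambda>x. x powr r) = E (\<lambda>x. x powr r) * W"
    unfolding D_def E_def mat_diag_mult_left[OF c(3)] mat_diag_mult_right[OF c(3)]
  proof (rule cong_mat, goal_cases)
    case (3 i j)
    then show ?case using *[of i j] by (cases "W $$ (i,j) = 0") auto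
  qed auto
  have "Y = V * W * D (\<lambda>x. x powr r) * U'" unfolding VW Y D_def U'_def ..
  also have "V * W * D (\<lambda>x. x powr r) = V * (W * D (\<lambda>x. x powr r))" by (simp only: assoc cs)
  also have "\<dots> = V * E (\<lambda>x. x powr r) * W" unfolding eq by (simp only: assoc cs)
  also have "\<dots> * U' = V * E (\<lambda>x. x powr r) * (W * U')" by (simp only: assoc cs)
  also have "\<dots> = Z" unfolding WU Z E_def V'_def ..
  finally show ?thesis .
qed

definition mat_powr :: "complex mat \<Rightarrow> real \<Rightarrow> complex mat" where
  "mat_powr X r = (THE Y. is_mat_powr X r Y)"

lemma mat_powr_eqI: "is_mat_powr X r Y \<Longrightarrow> mat_powr X r = Y"
  unfolding mat_powr_def using is_mat_powr_unique by blast

definition mat_trace :: "'a::comm_monoid_add mat \<Rightarrow> 'a" where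
  "mat_trace X = (\<Sum>i<dim_row X. X $$ (i, i))"

text \<open>The trace below is real, being that of a positive semidefinite matrix.\<close>

definition schatten_norm :: "real \<Rightarrow> complex mat \<Rightarrow> real" where
  "schatten_norm p X = Re (mat_trace (mat_powr (mat_adjoint X * X) (p / 2))) powr (1 / p)"

definition vec_pnorm :: "real \<Rightarrow> real vec \<Rightarrow> real" where
  "vec_pnorm p v = (\<Sum>i<dim_vec v. \<bar>v $ i\<bar> powr p) powr (1 / p)"

text \<open>
  The eigenvalues of \<open>X* X\<close> with multiplicity are the roots of its characteristic
  polynomial; they are real and nonnegative.
\<close>

definition singular_values :: "complex mat \<Rightarrow> real vec" where
  "singular_values X = vec_of_list (rev (sorted_list_of_multiset
     (image_mset (\<lambda>z. sqrt (Re z)) (proots (char_poly (mat_adjoint X * X))))))"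

end

theory Submission
  imports Defs
begin

text \<open>
  \<open>A + B\<close> and \<open>A - B\<close> both have the eigenvalues \<open>a, b = (11 \<plusminus> sqrt 5) / 2\<close>, while
  \<open>\<sigma>(A) \<plusminus> \<sigma>(B)\<close> has the entries \<open>7, 6\<close> and \<open>5, 4\<close>. The right-hand side minus the left-hand
  side is thus \<open>L(t powr p)\<close> with \<open>L(g) = g(7) + g(6) + g(5) + g(4) - 2 g(a) - 2 g(b)\<close>, a functional
  that annihilates cubic polynomials. Subtracting from \<open>g\<close> its cubic Hermite interpolant at the double
  nodes \<open>a\<close> and \<open>b\<close> removes the negative terms and leaves four remainders
  \<open>g''''(\<xi>) / 24 * ((x - a) * (x - b))^2\<close>, so the sign of \<open>L(t powr p)\<close> is that of
  \<open>p * (p - 1) * (p - 2) * (p - 3)\<close>.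
\<close>

section \<open>Rolle's theorem and cubic Hermite interpolation\<close>

lemma Rolle_deriv:
  fixes f f' :: "real \<Rightarrow> real"
  assumes "x < y" "f x = 0" "f y = 0"
    and "\<And>t. t \<in> {x..y} \<Longrightarrow> (f has_real_derivative f' t) (at t)"
  obtains z where "x < z" "z < y" "f' z = 0"
proof -
  have "\<exists>z. x < z \<and> z < y \<and> f y - f x = (y - x) * f' z"
    using assms by (intro MVT2) auto
  with assms that show thesis by auto
qed

text \<open>Each round of Rolle's theorem loses one zero: four of \<open>f\<close>, three of
  \<open>f1\<close>, two of \<open>f2\<close>, one of \<open>f3\<close>.\<close>

lemma Rolle_four_zeros:
  fixes f f1 f2 f3 :: "real \<Rightarrow> real"
  assumes "z1 < z2" "z2 < z3" "z3 < z4" "f z1 = 0" "f z2 = 0" "f z3 = 0" "f z4 = 0"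
    and d: "\<And>t. t \<in> {z1..z4} \<Longrightarrow> (f has_real_derivative f1 t) (at t)"
      "\<And>t. t \<in> {z1..z4} \<Longrightarrow> (f1 has_real_derivative f2 t) (at t)"
      "\<And>t. t \<in> {z1..z4} \<Longrightarrow> (f2 has_real_derivative f3 t) (at t)"
  obtains z where "z1 < z" "z < z4" "f3 z = 0"
proof -
  obtain u1 where u1: "z1 < u1" "u1 < z2" "f1 u1 = 0"
    by (rule Rolle_deriv[of z1 z2 f f1]) (use assms in auto)
  obtain u2 where u2: "z2 < u2" "u2 < z3" "f1 u2 = 0"
    by (rule Rolle_deriv[of z2 z3 f f1]) (use assms in auto)
  obtain u3 where u3: "z3 < u3" "u3 < z4" "f1 u3 = 0"
    by (rule Rolle_deriv[of z3 z4 f f1]) (use assms in auto)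
  obtain v1 where v1: "u1 < v1" "v1 < u2" "f2 v1 = 0"
    by (rule Rolle_deriv[of u1 u2 f1 f2]) (use assms u1 u2 u3 in auto)
  obtain v2 where v2: "u2 < v2" "v2 < u3" "f2 v2 = 0"
    by (rule Rolle_deriv[of u2 u3 f1 f2]) (use assms u1 u2 u3 in auto)
  obtain w where "v1 < w" "w < v2" "f3 w = 0"
    by (rule Rolle_deriv[of v1 v2 f2 f3]) (use assms u1 u2 u3 v1 v2 in auto)
  then show thesis using that[of w] u1 u3 v1 v2 by linarith
qed

text \<open>Rolle's theorem puts two zeros of \<open>f1\<close> strictly between the three zeros of
  \<open>f\<close>. Together with \<open>a\<close> and \<open>b\<close>, \<open>f1\<close> has four
  distinct zeros, so \<open>Rolle_four_zeros\<close> applies to it.\<close>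

lemma Rolle_two_double_zeros:
  fixes f f1 f2 f3 f4 :: "real \<Rightarrow> real"
  assumes S: "connected S" "a \<in> S" "b \<in> S" "x \<in> S"
    and ne: "a < b" "x \<noteq> a" "x \<noteq> b"
    and z: "f a = 0" "f b = 0" "f x = 0" "f1 a = 0" "f1 b = 0"
    and d: "\<And>t. t \<in> S \<Longrightarrow> (f has_real_derivative f1 t) (at t)"
      "\<And>t. t \<in> S \<Longrightarrow> (f1 has_real_derivative f2 t) (at t)"
      "\<And>t. t \<in> S \<Longrightarrow> (f2 has_real_derivative f3 t) (at t)"
      "\<And>t. t \<in> S \<Longrightarrow> (f3 has_real_derivative f4 t) (at t)"
  obtains z where "z \<in> S" "f4 z = 0"
proof -
  have mem: "t \<in> S" if "u \<in> S" "v \<in> S" "u \<le> t" "t \<le> v" for t u v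
    using connected_contains_Icc[OF S(1), of u v] that by auto
  have zero: thesis if zs: "z1 < z2" "z2 < z3" "z3 < z4" "f1 z1 = 0" "f1 z2 = 0" "f1 z3 = 0" "f1 z4 = 0"
    "z1 \<in> S" "z4 \<in> S" for z1 z2 z3 z4
  proof -
    have "{z1..z4} \<subseteq> S"
      by (rule connected_contains_Icc) (use S zs in auto)
    then have d': "(f1 has_real_derivative f2 t) (at t)" "(f2 has_real_derivative f3 t) (at t)"
      "(f3 has_real_derivative f4 t) (at t)" if "t \<in> {z1..z4}" for t
      using d that by auto
    obtain z where "z1 < z" "z < z4" "f4 z = 0"
      by (rule Rolle_four_zeros[of z1 z2 z3 z4 f1 f2 f3 f4]) (use zs d' in simp_all)
    then show thesis using \<open>\<And>z. _ \<Longrightarrow> _ \<Longrightarrow> thesis\<close> mem[of z1 z4 z] zs by auto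
  qed
  have between: "\<exists>t. u < t \<and> t < v \<and> f1 t = 0" if "u < v" "f u = 0" "f v = 0" "u \<in> S" "v \<in> S" for u v
    using Rolle_deriv[of u v f f1] that d(1) mem[of u v] by (metis atLeastAtMost_iff)
  \<comment> \<open>The position of \<open>x\<close> only decides the order in which the four zeros
    of \<open>f1\<close> occur.\<close>
  consider "x < a" | "a < x" "x < b" | "b < x" using ne by linarith
  then show thesis
  proof cases
    case 1
    then obtain s t where "x < s" "s < a" "f1 s = 0" "a < t" "t < b" "f1 t = 0"
      using between[of x a] between[of a b] S z ne by auto
    then show thesis using zero[of s a t b] z S mem[of x a s] by auto
  next
    case 2
    then obtain s t where "a < s" "s < x" "f1 s = 0" "x < t" "t < b" "f1 t = 0"
      using between[of a x] between[of x b] S z ne by auto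
    then show thesis using zero[of a s t b] z S by auto
  next
    case 3
    then obtain s t where "a < s" "s < b" "f1 s = 0" "b < t" "t < x" "f1 t = 0"
      using between[of a b] between[of b x] S z ne by auto
    then show thesis using zero[of a s b t] z S mem[of b x t] by auto
  qed
qed

text \<open>Newton's form with both nodes doubled, \<open>u + u' * (t - a) + \<alpha> * (t - a)^2 +
  \<beta> * (t - a)^2 * (t - b)\<close>, expanded into powers of \<open>t\<close>.\<close>

lemma cubic_hermite_interpolation:
  fixes a b u v u' v' :: real
  assumes "a \<noteq> b"
  obtains c0 c1 c2 c3 where
    "c0 + c1 * a + c2 * a^2 + c3 * a^3 = u" "c1 + 2 * c2 * a + 3 * c3 * a^2 = u'"
    "c0 + c1 * b + c2 * b^2 + c3 * b^3 = v" "c1 + 2 * c2 * b + 3 * c3 * b^2 = v'"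
proof -
  \<comment> \<open>The value at \<open>b\<close> forces \<open>\<alpha>\<close>; the slope at
    \<open>b\<close> then forces \<open>\<beta>\<close>.\<close>
  define \<alpha> where "\<alpha> = (v - u - u' * (b - a)) / (b - a)^2"
  define \<beta> where "\<beta> = (v' - u' - 2 * (b - a) * \<alpha>) / (b - a)^2"
  have 1: "\<alpha> * (b - a)^2 = v - u - u' * (b - a)" and 2: "\<beta> * (b - a)^2 = v' - u' - 2 * (b - a) * \<alpha>"
    using assms by (simp_all add: \<alpha>_def \<beta>_def)
  show thesis
  proof (rule that[of "u - u' * a + a^2 * (\<alpha> - \<beta> * b)" "u' - 2 * a * (\<alpha> - \<beta> * b) + \<beta> * a^2"
        "\<alpha> - \<beta> * b - 2 * a * \<beta>" \<beta>], goal_cases)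
    case 3
    show ?case using 1 by (simp add: algebra_simps power2_eq_square power3_eq_cube)
  next
    case 4
    show ?case using 2 by (simp add: algebra_simps power2_eq_square power3_eq_cube)
  qed (simp_all add: algebra_simps power2_eq_square power3_eq_cube)
qed

text \<open>Choose \<open>k\<close> so that \<open>g\<close> minus the cubic minus
  \<open>k * ((t - a) * (t - b))^2\<close> vanishes at \<open>x\<close> as well as doubly at
  \<open>a\<close> and \<open>b\<close>. Its fourth derivative \<open>g4 t - 24 * k\<close> then has
  a zero in \<open>S\<close>, which determines \<open>k\<close>.\<close>

lemma cubic_hermite_remainder:
  fixes g g1 g2 g3 g4 :: "real \<Rightarrow> real"
  assumes S: "connected S" "a \<in> S" "b \<in> S" "x \<in> S" and ab: "a < b"
    and d: "\<And>t. t \<in> S \<Longrightarrow> (g has_real_derivative g1 t) (at t)"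
      "\<And>t. t \<in> S \<Longrightarrow> (g1 has_real_derivative g2 t) (at t)"
      "\<And>t. t \<in> S \<Longrightarrow> (g2 has_real_derivative g3 t) (at t)"
      "\<And>t. t \<in> S \<Longrightarrow> (g3 has_real_derivative g4 t) (at t)"
    and c: "c0 + c1 * a + c2 * a^2 + c3 * a^3 = g a" "c1 + 2 * c2 * a + 3 * c3 * a^2 = g1 a"
      "c0 + c1 * b + c2 * b^2 + c3 * b^3 = g b" "c1 + 2 * c2 * b + 3 * c3 * b^2 = g1 b"
  obtains z where "z \<in> S"
    "g x - (c0 + c1 * x + c2 * x^2 + c3 * x^3) = g4 z / 24 * ((x - a) * (x - b))^2"
proof (cases "x = a \<or> x = b")
  case True
  \<comment> \<open>At a node both sides are zero, so any point of \<open>S\<close> serves.\<close>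
  then show thesis using that[OF \<open>a \<in> S\<close>] c by auto
next
  case False
  define k where "k = (g x - (c0 + c1 * x + c2 * x^2 + c3 * x^3)) / ((x - a) * (x - b))^2"
  \<comment> \<open>Written as \<open>t^2 - s * t + m\<close>, the node polynomial has derivative
    \<open>2 * t - s\<close>, which keeps the four derivatives below short.\<close>
  define s m where "s = a + b" and "m = a * b"
  have k: "g x - (c0 + c1 * x + c2 * x^2 + c3 * x^3) = k * ((x - a) * (x - b))^2"
    using False by (simp add: k_def)
  obtain z where "z \<in> S" "g4 z - 24 * k = 0"
  proof (rule Rolle_two_double_zeros[of S a b x
        "\<lambda>t. g t - (c0 + c1 * t + c2 * t^2 + c3 * t^3) - k * (t^2 - s * t + m)^2"
        "\<lambda>t. g1 t - (c1 + 2 * c2 * t + 3 * c3 * t^2) - 2 * k * (t^2 - s * t + m) * (2 * t - s)"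
        "\<lambda>t. g2 t - (2 * c2 + 6 * c3 * t) - k * (2 * (2 * t - s)^2 + 4 * (t^2 - s * t + m))"
        "\<lambda>t. g3 t - 6 * c3 - 12 * k * (2 * t - s)" "\<lambda>t. g4 t - 24 * k"])
    fix t assume t: "t \<in> S"
    show "((\<lambda>t. g t - (c0 + c1 * t + c2 * t^2 + c3 * t^3) - k * (t^2 - s * t + m)^2) has_real_derivative
      g1 t - (c1 + 2 * c2 * t + 3 * c3 * t^2) - 2 * k * (t^2 - s * t + m) * (2 * t - s)) (at t)"
      by (rule derivative_eq_intros d t refl | simp)+
    show "((\<lambda>t. g1 t - (c1 + 2 * c2 * t + 3 * c3 * t^2) - 2 * k * (t^2 - s * t + m) * (2 * t - s))
      has_real_derivative
      g2 t - (2 * c2 + 6 * c3 * t) - k * (2 * (2 * t - s)^2 + 4 * (t^2 - s * t + m))) (at t)"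
      by (rule derivative_eq_intros d t refl | simp)+ (simp add: algebra_simps power2_eq_square)
    show "((\<lambda>t. g2 t - (2 * c2 + 6 * c3 * t) - k * (2 * (2 * t - s)^2 + 4 * (t^2 - s * t + m)))
      has_real_derivative g3 t - 6 * c3 - 12 * k * (2 * t - s)) (at t)"
      by (rule derivative_eq_intros d t refl | simp)+
    show "((\<lambda>t. g3 t - 6 * c3 - 12 * k * (2 * t - s)) has_real_derivative g4 t - 24 * k) (at t)"
      by (rule derivative_eq_intros d t refl | simp)+
  next
    have "(x - a) * (x - b) = x^2 - s * x + m"
      by (simp add: s_def m_def power2_eq_square algebra_simps)
    then show "g x - (c0 + c1 * x + c2 * x^2 + c3 * x^3) - k * (x^2 - s * x + m)^2 = 0"
      using k by simp
  qed (use S ab c False in \<open>auto simp: s_def m_def power2_eq_square algebra_simps\<close>)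
  then show thesis using that[of z] k by simp
qed

section \<open>The power function at the points 4, 5, 6, 7\<close>

text \<open>Here \<open>a\<close> and \<open>b\<close> are the roots of
  \<open>t^2 - 11 * t + 29\<close>. The nonnegative factor \<open>C\<close> collects the four
  Hermite remainders, so that only the sign of a polynomial in \<open>p\<close> remains to be
  discussed.\<close>

lemma powr_remainder_sum:
  fixes a b p :: real
  assumes "0 < b" "b < a" "a + b = 11" "a * b = 29"
  obtains C where "C \<ge> 0"
    "7 powr p + 6 powr p + 5 powr p + 4 powr p - 2 * (a powr p + b powr p) =
     p * (p - 1) * (p - 2) * (p - 3) * C"
proof -
  define g where "g = (\<lambda>t::real. t powr p)"
  define g1 where "g1 = (\<lambda>t. p * t powr (p - 1))"
  define g2 where "g2 = (\<lambda>t. p * (p - 1) * t powr (p - 2))"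
  define g3 where "g3 = (\<lambda>t. p * (p - 1) * (p - 2) * t powr (p - 3))"
  define g4 where "g4 = (\<lambda>t. p * (p - 1) * (p - 2) * (p - 3) * t powr (p - 4))"
  have d: "(g has_real_derivative g1 t) (at t)" "(g1 has_real_derivative g2 t) (at t)"
    "(g2 has_real_derivative g3 t) (at t)" "(g3 has_real_derivative g4 t) (at t)"
    if "t \<in> {0<..}" for t
    using that unfolding g_def g1_def g2_def g3_def g4_def
    by (auto intro!: derivative_eq_intros simp: algebra_simps)
  obtain c0 c1 c2 c3 where c:
    "c0 + c1 * b + c2 * b^2 + c3 * b^3 = g b" "c1 + 2 * c2 * b + 3 * c3 * b^2 = g1 b"
    "c0 + c1 * a + c2 * a^2 + c3 * a^3 = g a" "c1 + 2 * c2 * a + 3 * c3 * a^2 = g1 a"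
    using cubic_hermite_interpolation[of b a] assms by (metis less_irrefl)
  define q where "q = (\<lambda>x. c0 + c1 * x + c2 * x^2 + c3 * x^3)"
  have "\<exists>C\<ge>0. g x - q x = p * (p - 1) * (p - 2) * (p - 3) * C" if x: "x > 0" for x
  proof -
    obtain z where "z \<in> {0<..}" "g x - q x = g4 z / 24 * ((x - b) * (x - a))^2"
      unfolding q_def by (rule cubic_hermite_remainder[of "{0<..}" b a x g g1 g2 g3 g4])
        (use assms x c d in auto)
    then show ?thesis
      by (intro exI[of _ "z powr (p - 4) / 24 * ((x - b) * (x - a))^2"]) (simp add: g4_def)
  qed
  then obtain C where C: "\<And>x. x > 0 \<Longrightarrow> C x \<ge> 0 \<and> g x - q x = p * (p - 1) * (p - 2) * (p - 3) * C x"
    by metis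
  have b: "b = 11 - a"
    using assms(3) by simp
  have sq: "a^2 = 11 * a - 29" "b^2 = 11 * b - 29"
    using assms(4) unfolding b by (simp_all add: power2_eq_square algebra_simps)
  have cube: "t^3 = 92 * t - 319" if "t^2 = 11 * t - 29" for t :: real
  proof -
    have "t^3 = 11 * t^2 - 29 * t"
      using arg_cong[OF that, of "(*) t"] by (simp add: power2_eq_square power3_eq_cube algebra_simps)
    with that show ?thesis by simp
  qed
  \<comment> \<open>Reduced modulo \<open>t^2 - 11 * t + 29\<close>, the cubic is linear in
    \<open>a\<close> and \<open>b\<close>, and \<open>a + b = 11\<close> eliminates both. The first,
    second and third power sums on either side are 22, 126 and 748.\<close>
  have "q 7 + q 6 + q 5 + q 4 = 2 * (q a + q b)"
    unfolding q_def sq cube[OF sq(1)] cube[OF sq(2)] unfolding b by (simp add: algebra_simps)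
  moreover have "q a = g a" "q b = g b" using c by (simp_all add: q_def)
  ultimately have "g 7 + g 6 + g 5 + g 4 - 2 * (g a + g b) =
      (g 7 - q 7) + (g 6 - q 6) + (g 5 - q 5) + (g 4 - q 4)"
    by simp
  also have "\<dots> = p * (p - 1) * (p - 2) * (p - 3) * (C 7 + C 6 + C 5 + C 4)"
    using C[of 7] C[of 6] C[of 5] C[of 4] by (simp add: distrib_left)
  finally show thesis
    using that[of "C 7 + C 6 + C 5 + C 4"] C[of 7] C[of 6] C[of 5] C[of 4] by (simp add: g_def)
qed

section \<open>Real symmetric two-by-two matrices\<close>

text \<open>This shape is closed under adjoints, squares and the functional calculus, so every
  matrix that is evaluated below has it.\<close>

definition sym2 :: "real \<Rightarrow> real \<Rightarrow> real \<Rightarrow> complex mat" where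
  "sym2 x y z = mat_of_rows_list 2
     [[complex_of_real x, complex_of_real y], [complex_of_real y, complex_of_real z]]"

lemma sym2_carrier [simp]: "sym2 x y z \<in> carrier_mat 2 2"
  and sym2_dim [simp]: "dim_row (sym2 x y z) = 2" "dim_col (sym2 x y z) = 2"
  by (auto simp: sym2_def mat_of_rows_list_def)

lemma sym2_index [simp]:
  "sym2 x y z $$ (0, 0) = complex_of_real x" "sym2 x y z $$ (0, Suc 0) = complex_of_real y"
  "sym2 x y z $$ (Suc 0, 0) = complex_of_real y" "sym2 x y z $$ (Suc 0, Suc 0) = complex_of_real z"
  by (auto simp: sym2_def mat_of_rows_list_def)

lemma eq_mat2I:
  assumes "M \<in> carrier_mat 2 2" "N \<in> carrier_mat 2 2"
    "M $$ (0, 0) = N $$ (0, 0)" "M $$ (0, Suc 0) = N $$ (0, Suc 0)"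
    "M $$ (Suc 0, 0) = N $$ (Suc 0, 0)" "M $$ (Suc 0, Suc 0) = N $$ (Suc 0, Suc 0)"
  shows "M = N"
  using assms by (intro eq_matI) (auto simp: less_2_cases_iff)

text \<open>Replaces \<open>index_mult_mat(1)\<close>, which would turn entries of products into
  scalar products of rows and columns.\<close>

lemma index_mult_mat2:
  assumes "M \<in> carrier_mat 2 2" "N \<in> carrier_mat 2 2" "i < 2" "j < 2"
  shows "(M * N) $$ (i, j) = M $$ (i, 0) * N $$ (0, j) + M $$ (i, Suc 0) * N $$ (Suc 0, j)"
  using assms by (auto simp: times_mat_def scalar_prod_def sum.atLeast0_lessThan_Suc numeral_2_eq_2)

lemma index_mat_adjoint [simp]:
  assumes "i < dim_col M" "j < dim_row M"
  shows "mat_adjoint M $$ (i, j) = cnj (M $$ (j, i))"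
  using assms by (simp add: mat_adjoint_def mat_of_rows_def col_def)

lemma mat_adjoint_sym2 [simp]: "mat_adjoint (sym2 x y z) = sym2 x y z"
  by (intro eq_mat2I mat_adjoint_carrier) auto

lemma sym2_mult_self:
  "sym2 x y z * sym2 x y z = sym2 (x^2 + y^2) (x * y + y * z) (y^2 + z^2)"
  by (intro eq_mat2I mult_carrier_mat[of _ _ 2])
    (auto simp: index_mult_mat2[of "sym2 x y z" "sym2 x y z"] power2_eq_square simp del: index_mult_mat(1))

text \<open>The hypothesis kills the off-diagonal entry of the square, so the eigenvalues can be
  read off its diagonal.\<close>

lemma singular_values_sym2:
  assumes "x * y + y * z = 0"
  shows "singular_values (sym2 x y z) =
    vec_of_list (rev (sorted_list_of_multiset {#sqrt (x^2 + y^2), sqrt (y^2 + z^2)#}))"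
proof -
  define u w where "u = x^2 + y^2" and "w = y^2 + z^2"
  have "upper_triangular (sym2 u 0 w)"
    by (auto simp: upper_triangular_def less_2_cases_iff)
  then have "char_poly (sym2 u 0 w) = [:- complex_of_real u, 1:] * [:- complex_of_real w, 1:]"
    by (subst char_poly_upper_triangular[of _ 2]) (simp_all add: diag_mat_def upt_rec[of _ 2])
  then have "proots (char_poly (sym2 u 0 w)) = {#complex_of_real u, complex_of_real w#}"
    by (simp add: proots_mult del: mult_pCons_left mult_pCons_right)
  then show ?thesis
    using assms by (simp add: singular_values_def sym2_mult_self u_def w_def)
qed

text \<open>The equations for \<open>x\<close>, \<open>y\<close>, \<open>z\<close> say that the
  matrix has eigenvalues \<open>d1\<close> and \<open>d2\<close> with eigenvectors
  \<open>(c, s)\<close> and \<open>(-s, c)\<close>.\<close>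

lemma schatten_norm_sym2:
  assumes p: "p > 0" and cs: "c^2 + s^2 = 1" and d: "d1 \<ge> 0" "d2 \<ge> 0"
    and x: "x = c^2 * d1 + s^2 * d2" and y: "y = c * s * (d1 - d2)" and z: "z = s^2 * d1 + c^2 * d2"
  shows "schatten_norm p (sym2 x y z) powr p = d1 powr p + d2 powr p"
proof -
  define U where "U = mat_of_rows_list 2
    [[complex_of_real c, - complex_of_real s], [complex_of_real s, complex_of_real c]]"
  have U: "U \<in> carrier_mat 2 2" "dim_row U = 2" "dim_col U = 2"
    by (auto simp: U_def mat_of_rows_list_def)
  have Ui: "U $$ (0, 0) = complex_of_real c" "U $$ (0, Suc 0) = - complex_of_real s"
    "U $$ (Suc 0, 0) = complex_of_real s" "U $$ (Suc 0, Suc 0) = complex_of_real c"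
    by (auto simp: U_def mat_of_rows_list_def)
  note U' = mat_adjoint_carrier[OF U(1)]
  have cs': "complex_of_real c * complex_of_real c + complex_of_real s * complex_of_real s = 1"
    using cs by (metis of_real_1 of_real_add of_real_mult power2_eq_square)
  have "mat_adjoint U * U = 1\<^sub>m 2" "U * mat_adjoint U = 1\<^sub>m 2"
    using cs' by (intro eq_mat2I mult_carrier_mat[of _ _ 2] U U' one_carrier_mat;
      simp add: index_mult_mat2[OF U(1) U'] index_mult_mat2[OF U' U(1)] U Ui algebra_simps
        del: index_mult_mat(1))+
  then have unitary: "unitary_mat U"
    by (simp add: unitary_mat_def U)
  \<comment> \<open>Needed for two choices of \<open>e\<close>: the eigenvalues of the squared
    matrix and their powers \<open>p / 2\<close>.\<close>
  have conj: "U * mat_diag 2 (\<lambda>i. complex_of_real (e i)) * mat_adjoint U =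
      sym2 (c^2 * e 0 + s^2 * e (Suc 0)) (c * s * (e 0 - e (Suc 0))) (s^2 * e 0 + c^2 * e (Suc 0))"
    for e :: "nat \<Rightarrow> real"
  proof -
    define D where "D = mat_diag 2 (\<lambda>i. complex_of_real (e i))"
    have D: "D \<in> carrier_mat 2 2" "D $$ (0, 0) = e 0" "D $$ (0, Suc 0) = 0" "D $$ (Suc 0, 0) = 0"
      "D $$ (Suc 0, Suc 0) = e (Suc 0)"
      by (simp_all add: D_def mat_diag_def)
    note UD = mult_carrier_mat[OF U(1) D(1)]
    show ?thesis
      unfolding D_def[symmetric]
      by (intro eq_mat2I mult_carrier_mat[OF UD U'] sym2_carrier;
        simp add: index_mult_mat2[OF UD U'] index_mult_mat2[OF U(1) D(1)] U Ui D
          power2_eq_square algebra_simps del: index_mult_mat(1))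
  qed
  \<comment> \<open>Squares, because the power is taken of the squared matrix. The value at indices
    above 1 is also nonnegative, as \<open>is_mat_powr\<close> demands of every index.\<close>
  define e where "e = (\<lambda>i::nat. if i = 0 then d1^2 else d2^2)"
  \<comment> \<open>With the factor \<open>c^2 + s^2\<close> left in place these are polynomial
    identities; afterwards it is replaced by 1.\<close>
  have "x^2 + y^2 = (c^2 + s^2) * (c^2 * d1^2 + s^2 * d2^2)"
    "x * y + y * z = (c^2 + s^2) * (c * s * (d1^2 - d2^2))"
    "y^2 + z^2 = (c^2 + s^2) * (s^2 * d1^2 + c^2 * d2^2)"
    unfolding x y z by (simp_all add: power2_eq_square algebra_simps)
  then have sq: "x^2 + y^2 = c^2 * d1^2 + s^2 * d2^2" "x * y + y * z = c * s * (d1^2 - d2^2)"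
    "y^2 + z^2 = s^2 * d1^2 + c^2 * d2^2"
    by (simp_all add: cs)
  have "is_mat_powr (mat_adjoint (sym2 x y z) * sym2 x y z) (p / 2)
    (U * mat_diag 2 (\<lambda>i. complex_of_real (e i powr (p / 2))) * mat_adjoint U)"
    unfolding is_mat_powr_def
    by (rule exI[of _ U], rule exI[of _ e])
      (use U unitary in \<open>simp add: sym2_mult_self conj sq, simp add: e_def\<close>)
  then have "mat_powr (mat_adjoint (sym2 x y z) * sym2 x y z) (p / 2) =
    sym2 (c^2 * e 0 powr (p / 2) + s^2 * e (Suc 0) powr (p / 2))
      (c * s * (e 0 powr (p / 2) - e (Suc 0) powr (p / 2)))
      (s^2 * e 0 powr (p / 2) + c^2 * e (Suc 0) powr (p / 2))"
    by (simp add: mat_powr_eqI conj)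
  then have "Re (mat_trace (mat_powr (mat_adjoint (sym2 x y z) * sym2 x y z) (p / 2))) =
    (c^2 + s^2) * (e 0 powr (p / 2) + e (Suc 0) powr (p / 2))"
    by (simp add: mat_trace_def numeral_2_eq_2 algebra_simps)
  also have "\<dots> = d1 powr p + d2 powr p"
    using cs d by (simp add: e_def powr_powr flip: powr_numeral)
  finally show ?thesis
    using p by (simp add: schatten_norm_def powr_powr)
qed

text \<open>As the entries are real, the form at a complex vector is the sum of the real quadratic
  forms at its real and imaginary parts.\<close>

lemma psd_mat_sym2:
  assumes "0 \<le> x" "0 \<le> z" "y^2 \<le> x * z"
  shows "psd_mat (sym2 x y z)"
  unfolding psd_mat_def self_adjoint_mat_def
proof (intro conjI ballI)
  fix v :: "complex vec" assume v: "v \<in> carrier_vec (dim_row (sym2 x y z))"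
  define r s where "r = v $ 0" and "s = v $ Suc 0"
  \<comment> \<open>Completing the square after multiplication by \<open>x\<close>; if
    \<open>x = 0\<close>, then also \<open>y = 0\<close>.\<close>
  have form: "0 \<le> x * a^2 + 2 * y * (a * b) + z * b^2" for a b :: real
  proof (cases "x = 0")
    case True
    then show ?thesis using assms by simp
  next
    case False
    have "x * (x * a^2 + 2 * y * (a * b) + z * b^2) = (x * a + y * b)^2 + (x * z - y^2) * b^2"
      by (simp add: power2_eq_square algebra_simps)
    also have "\<dots> \<ge> 0" using assms by simp
    finally show ?thesis using assms False by (simp add: zero_le_mult_iff)
  qed
  have "Re ((sym2 x y z *\<^sub>v v) \<bullet>c v) =
    (x * (Re r)^2 + 2 * y * (Re r * Re s) + z * (Re s)^2) +
    (x * (Im r)^2 + 2 * y * (Im r * Im s) + z * (Im s)^2)"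
    using v by (simp add: scalar_prod_def numeral_2_eq_2 r_def s_def power2_eq_square
      algebra_simps)
  also have "\<dots> \<ge> 0" using form[of "Re r" "Re s"] form[of "Im r" "Im s"] by linarith
  finally show "0 \<le> Re ((sym2 x y z *\<^sub>v v) \<bullet>c v)" .
qed auto

section \<open>The matrices of the example\<close>

text \<open>Covers \<open>A + B\<close> and \<open>A - B\<close> at once: the sign of
  \<open>y\<close> only flips the second component of the eigenvector, not the eigenvalues.\<close>

lemma schatten_norm_example:
  assumes "p > 0" "y^2 = 1"
  shows "schatten_norm p (sym2 6 y 5) powr p =
    ((11 + sqrt 5) / 2) powr p + ((11 - sqrt 5) / 2) powr p"
proof -
  \<comment> \<open>\<open>(c, s)\<close> is the unit eigenvector for the eigenvalue \<open>(11 + sqrt 5) / 2\<close>.\<close>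
  define c s where "c = sqrt ((5 + sqrt 5) / 10)" and "s = y * sqrt ((5 - sqrt 5) / 10)"
  have s5: "sqrt 5 \<le> (5::real)" by (rule real_le_lsqrt) auto
  have c2: "c^2 = (5 + sqrt 5) / 10" and s2: "s^2 = (5 - sqrt 5) / 10"
    using s5 assms by (simp_all add: c_def s_def power_mult_distrib)
  \<comment> \<open>The off-diagonal entry must be \<open>c * s\<close> times the eigenvalue gap
    \<open>sqrt 5\<close>.\<close>
  have "c * s = y * sqrt ((5 + sqrt 5) / 10 * ((5 - sqrt 5) / 10))"
    by (simp only: c_def s_def real_sqrt_mult mult.left_commute)
  also have "(5 + sqrt 5) / 10 * ((5 - sqrt 5) / 10) = (sqrt 5 / 5)^2"
    by (simp add: field_simps power2_eq_square)
  finally have "c * s = y * (sqrt 5 / 5)" by simp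
  then have cs: "c * s * sqrt 5 = y" by (simp only:) simp
  show ?thesis
  proof (rule schatten_norm_sym2[OF \<open>p > 0\<close>, of c s])
    have "(11 + sqrt 5) / 2 - (11 - sqrt 5) / 2 = sqrt 5"
      by (simp add: field_simps)
    then show "y = c * s * ((11 + sqrt 5) / 2 - (11 - sqrt 5) / 2)"
      by (simp only: cs)
  qed (use s5 in \<open>simp_all add: c2 s2 field_simps\<close>)
qed

lemma matrices_eq_sym2:
  fixes A B :: "complex mat"
  assumes A: "A = mat_of_rows_list 2 [[6, 0], [0, 5]]"
    and B: "B = mat_of_rows_list 2 [[0, 1], [1, 0]]"
  shows "A = sym2 6 0 5" "B = sym2 0 1 0" "A + B = sym2 6 1 5" "A - B = sym2 6 (-1) 5"
proof -
  show AB: "A = sym2 6 0 5" "B = sym2 0 1 0"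
    by (simp_all add: A B sym2_def)
  show "A + B = sym2 6 1 5" "A - B = sym2 6 (-1) 5"
    unfolding AB by (intro eq_mat2I; auto)+
qed

text \<open>Sum and difference of these vectors are (7, 6) and (5, 4), the four points of
  \<open>powr_remainder_sum\<close>.\<close>

lemma singular_values_example:
  "singular_values (sym2 6 0 5) = vec_of_list [6, 5]"
  "singular_values (sym2 0 1 0) = vec_of_list [1, 1]"
  by (simp_all add: singular_values_sym2)

lemma vec_pnorm_powr:
  assumes "p > 0"
  shows "vec_pnorm p v powr p = (\<Sum>i<dim_vec v. \<bar>v $ i\<bar> powr p)"
  using assms by (simp add: vec_pnorm_def powr_powr sum_nonneg)

theorem mainTheorem6:
  fixes A B :: "complex mat"
  assumes A: "A = mat_of_rows_list 2 [[6, 0], [0, 5]]"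
    and B: "B = mat_of_rows_list 2 [[0, 1], [1, 0]]"
  shows "psd_mat (A + B) \<and> psd_mat (A - B) \<and>
    (\<forall>p::real. (1 \<le> p \<and> p \<le> 2) \<or> 3 \<le> p \<longrightarrow>
       schatten_norm p (A + B) powr p + schatten_norm p (A - B) powr p
         \<le> vec_pnorm p (singular_values A + singular_values B) powr p
           + vec_pnorm p (singular_values A - singular_values B) powr p) \<and>
    (\<forall>p::real. 2 \<le> p \<and> p \<le> 3 \<longrightarrow>
       schatten_norm p (A + B) powr p + schatten_norm p (A - B) powr p
         \<ge> vec_pnorm p (singular_values A + singular_values B) powr p
           + vec_pnorm p (singular_values A - singular_values B) powr p)"
proof -
  note m = matrices_eq_sym2[OF A B]
  define a b where "a = (11 + sqrt 5) / 2" and "b = (11 - sqrt 5) / 2"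
  have "sqrt 5 < (11::real)" by (rule real_less_lsqrt) auto
  then have ab: "0 < b" "b < a" "a + b = 11" "a * b = 29"
    by (simp_all add: a_def b_def field_simps)
  have psd: "psd_mat (A + B)" "psd_mat (A - B)"
    unfolding m(3,4) by (rule psd_mat_sym2; simp)+
  define lhs rhs where
    "lhs = (\<lambda>p. schatten_norm p (A + B) powr p + schatten_norm p (A - B) powr p)" and
    "rhs = (\<lambda>p. vec_pnorm p (singular_values A + singular_values B) powr p
      + vec_pnorm p (singular_values A - singular_values B) powr p)"
  \<comment> \<open>Both Schatten norms give the same value, whence the factor 2 in front of
    \<open>a powr p + b powr p\<close>.\<close>
  have diff: "\<exists>C\<ge>0. rhs p - lhs p = p * (p - 1) * (p - 2) * (p - 3) * C" if p: "p \<ge> 1" for p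
  proof -
    obtain C where "C \<ge> 0" "7 powr p + 6 powr p + 5 powr p + 4 powr p - 2 * (a powr p + b powr p) =
      p * (p - 1) * (p - 2) * (p - 3) * C"
      using powr_remainder_sum[OF ab] by blast
    then show ?thesis
      unfolding lhs_def rhs_def m(3,4) unfolding m(1,2) singular_values_example
      using p by (intro exI[of _ C])
        (simp add: vec_pnorm_powr schatten_norm_example numeral_2_eq_2 flip: a_def b_def)
  qed
  have "lhs p \<le> rhs p" if p: "1 \<le> p \<and> p \<le> 2 \<or> 3 \<le> p" for p
  proof -
    obtain C where "C \<ge> 0" "rhs p - lhs p = p * (p - 1) * (p - 2) * (p - 3) * C"
      using diff[of p] p by auto
    \<comment> \<open>Grouped in pairs, since for these \<open>p\<close> the numbers
      \<open>p - 2\<close> and \<open>p - 3\<close> never have opposite signs.\<close>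
    moreover have "p * (p - 1) \<ge> 0" "(p - 2) * (p - 3) \<ge> 0"
      using p by (auto simp: zero_le_mult_iff)
    ultimately show ?thesis
      by (metis diff_ge_0_iff_ge mult.assoc mult_nonneg_nonneg)
  qed
  moreover have "rhs p \<le> lhs p" if p: "2 \<le> p \<and> p \<le> 3" for p
  proof -
    obtain C where "C \<ge> 0" "rhs p - lhs p = p * (p - 1) * (p - 2) * (p - 3) * C"
      using diff[of p] p by auto
    moreover have "p * (p - 1) * (p - 2) * (p - 3) \<le> 0"
      using p by (intro mult_nonneg_nonpos mult_nonneg_nonneg) auto
    ultimately show ?thesis
      by (metis diff_le_0_iff_le mult_nonpos_nonneg)
  qed
  ultimately show ?thesis
    using psd by (simp add: lhs_def rhs_def)
qed

end
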